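(* Let $\{(x_i,y_i)\}_{i=1}^6\subset\mathbb{P}^2\times\mathbb{P}^2$ be a configuration such that $\{x_i\}$ and $\{y_i\}$ are each in general position, and let $Z_6$ be the $6\times 9$ matrix with rows $x_i^\top\otimes y_i^\top$. Then $$(\bar a_x,\bar b_x,\bar c_x,\bar d_x,\bar e_x,\bar f_x)\sim(\bar a_y,\bar b_y,\bar c_y,\bar d_y,\bar e_y,\bar f_y)$$ if and only if either the matrix $Z_6$ is rank deficient (i.e. $\operatorname{rank}(Z_6)<6$) or there is a homography $H\in\mathrm{PGL}(3)$ such that $y_i=Hx_i$ for $i=1,\dots,6$.
   Context: $\mathbb{P}^2$ is the projective plane over $\mathbb{C}$; points are represented by nonzero column vectors, $\otimes$ is the Kronecker product, and $\sim$ means equal up to a nonzero scalar. Six points in $\mathbb{P}^2$ are in general position if at most $2$ of them are in a line and at most $5$ of them are on a conic. For $p_1,\dots,p_6\in\mathbb{P}^2$, $[ijl]$ is the determinant of the $3\times3$ matrix with rows $p_i^\top,p_j^\top,p_l^\top$, and $[(ij)(kl)(rs)]:=[ijr][kls]-[ijs][klr]$. Define $$\begin{aligned} \bar a&=[(25)(13)(46)]+[(51)(42)(36)]+[(14)(35)(26)]+[(43)(21)(56)]+[(32)(54)(16)]\\ \bar b&=[(53)(12)(46)]+[(14)(23)(56)]+[(25)(34)(16)]+[(31)(45)(26)]+[(42)(51)(36)]\\ \bar c&=[(53)(41)(26)]+[(34)(25)(16)]+[(42)(13)(56)]+[(21)(54)(36)]+[(15)(32)(46)]\\ \bar d&=[(45)(31)(26)]+[(53)(24)(16)]+[(41)(25)(36)]+[(32)(15)(46)]+[(21)(43)(56)]\\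 \bar e&=[(31)(24)(56)]+[(12)(53)(46)]+[(25)(41)(36)]+[(54)(32)(16)]+[(43)(15)(26)]\\ \bar f&=[(42)(35)(16)]+[(23)(14)(56)]+[(31)(52)(46)]+[(15)(43)(26)]+[(54)(21)(36)] \end{aligned}$$ The subscript $x$ (respectively $y$) means that these are evaluated at $p_i=x_i$ (respectively $p_i=y_i$). *)

theory Defs
  imports "HOL-Analysis.Analysis"
begin

text \<open>
  Points of the complex projective plane are represented by nonzero vectors in \<open>complex^3\<close>.
  Six-point configurations are families indexed by the six-element type \<open>6\<close>; its elements are
  \<open>1, \<dots>, 6\<close>, where \<open>6 = 0\<close> because numerals of this type are taken modulo 6.
\<close>

definition proj_eq :: "complex^'n \<Rightarrow> complex^'n \<Rightarrow> bool"  (infix "\<sim>\<^sub>P" 50) where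
  "u \<sim>\<^sub>P v \<longleftrightarrow> (\<exists>c. c \<noteq> 0 \<and> u = c *s v)"

text \<open>
  The bilinear sums are written out because the inner product of HOL-Analysis on
  \<open>complex^3\<close> is the real one. A line is given by a nonzero coefficient vector, a conic by a
  nonzero symmetric matrix.
\<close>

definition on_line :: "complex^3 \<Rightarrow> complex^3 \<Rightarrow> bool" where
  "on_line l p \<longleftrightarrow> (\<Sum>k\<in>UNIV. l $ k * p $ k) = 0"

definition on_conic :: "complex^3^3 \<Rightarrow> complex^3 \<Rightarrow> bool" where
  "on_conic Q p \<longleftrightarrow> (\<Sum>i\<in>UNIV. \<Sum>j\<in>UNIV. Q $ i $ j * p $ i * p $ j) = 0"

text \<open>Points are counted by index, so coinciding points count with multiplicity.\<close>

definition general_position :: "(6 \<Rightarrow> complex^3) \<Rightarrow> bool" where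
  "general_position p \<longleftrightarrow>
     (\<forall>l. l \<noteq> 0 \<longrightarrow> card {i. on_line l (p i)} \<le> 2) \<and>
     (\<forall>Q. Q \<noteq> 0 \<and> transpose Q = Q \<longrightarrow> card {i. on_conic Q (p i)} \<le> 5)"

text \<open>
  The Kronecker product of vectors: its coordinates are indexed by pairs, so that for
  \<open>complex^3\<close> the index type \<open>3 \<times> 3\<close> has nine elements.
\<close>

definition kron :: "complex^'m \<Rightarrow> complex^'n \<Rightarrow> complex^('m \<times> 'n)"  (infixr "\<otimes>\<^sub>K" 70) where
  "u \<otimes>\<^sub>K v = (\<chi> k. u $ fst k * v $ snd k)"

definition Z6 :: "(6 \<Rightarrow> complex^3) \<Rightarrow> (6 \<Rightarrow> complex^3) \<Rightarrow> complex^(3 \<times> 3)^6" where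
  "Z6 x y = (\<chi> i. x i \<otimes>\<^sub>K y i)"

definition bracket :: "(6 \<Rightarrow> complex^3) \<Rightarrow> 6 \<Rightarrow> 6 \<Rightarrow> 6 \<Rightarrow> complex" where
  "bracket p i j l = det (vector [p i, p j, p l] :: complex^3^3)"

text \<open>\<open>bracket2 p (i,j) (k,l) (r,s)\<close> is the invariant written $[(ij)(kl)(rs)]$.\<close>

fun bracket2 :: "(6 \<Rightarrow> complex^3) \<Rightarrow> 6 \<times> 6 \<Rightarrow> 6 \<times> 6 \<Rightarrow> 6 \<times> 6 \<Rightarrow> complex" where
  "bracket2 p (i,j) (k,l) (r,s) =
     bracket p i j r * bracket p k l s - bracket p i j s * bracket p k l r"

definition abar :: "(6 \<Rightarrow> complex^3) \<Rightarrow> complex" where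
  "abar p =
     bracket2 p (2,5) (1,3) (4,6)
   + bracket2 p (5,1) (4,2) (3,6)
   + bracket2 p (1,4) (3,5) (2,6)
   + bracket2 p (4,3) (2,1) (5,6)
   + bracket2 p (3,2) (5,4) (1,6)"

definition bbar :: "(6 \<Rightarrow> complex^3) \<Rightarrow> complex" where
  "bbar p =
     bracket2 p (5,3) (1,2) (4,6)
   + bracket2 p (1,4) (2,3) (5,6)
   + bracket2 p (2,5) (3,4) (1,6)
   + bracket2 p (3,1) (4,5) (2,6)
   + bracket2 p (4,2) (5,1) (3,6)"

definition cbar :: "(6 \<Rightarrow> complex^3) \<Rightarrow> complex" where
  "cbar p =
     bracket2 p (5,3) (4,1) (2,6)
   + bracket2 p (3,4) (2,5) (1,6)
   + bracket2 p (4,2) (1,3) (5,6)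
   + bracket2 p (2,1) (5,4) (3,6)
   + bracket2 p (1,5) (3,2) (4,6)"

definition dbar :: "(6 \<Rightarrow> complex^3) \<Rightarrow> complex" where
  "dbar p =
     bracket2 p (4,5) (3,1) (2,6)
   + bracket2 p (5,3) (2,4) (1,6)
   + bracket2 p (4,1) (2,5) (3,6)
   + bracket2 p (3,2) (1,5) (4,6)
   + bracket2 p (2,1) (4,3) (5,6)"

definition ebar :: "(6 \<Rightarrow> complex^3) \<Rightarrow> complex" where
  "ebar p =
     bracket2 p (3,1) (2,4) (5,6)
   + bracket2 p (1,2) (5,3) (4,6)
   + bracket2 p (2,5) (4,1) (3,6)
   + bracket2 p (5,4) (3,2) (1,6)
   + bracket2 p (4,3) (1,5) (2,6)"

definition fbar :: "(6 \<Rightarrow> complex^3) \<Rightarrow> complex" where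
  "fbar p =
     bracket2 p (4,2) (3,5) (1,6)
   + bracket2 p (2,3) (1,4) (5,6)
   + bracket2 p (3,1) (5,2) (4,6)
   + bracket2 p (1,5) (4,3) (2,6)
   + bracket2 p (5,4) (2,1) (3,6)"

definition bar_vec :: "(6 \<Rightarrow> complex^3) \<Rightarrow> complex^6" where
  "bar_vec p = vector [abar p, bbar p, cbar p, dbar p, ebar p, fbar p]"

end

theory Submission
  imports Defs
begin

text \<open>
  No three of the points of a configuration \<open>x\<close> are collinear, so the first three may serve as
  a basis: up to a linear change of coordinates, \<open>x\<close> consists of the rows of the identity and
  of the rows of a \<open>3 \<times> 3\<close> matrix \<open>B\<close>. Here \<open>B\<close> has nonzero determinant, entries and \<open>2 \<times> 2\<close>
  minors, because these are, up to sign, the brackets of the points in these coordinates. Likewise \<open>y\<close>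
  is given by a matrix \<open>B'\<close>. The three conditions of the theorem do not see the change of coordinates, and
  each of them becomes a condition on \<open>B\<close> and \<open>B'\<close>.

  A homography must fix the three coordinate points, hence is diagonal. So it exists iff \<open>B\<close> and
  \<open>B'\<close> agree up to rescaling of rows and columns (\<open>torus_equiv\<close>; \<open>homographic_frame_iff\<close>).
  A dependency between the rows of \<open>Z\<^sub>6\<close> reads \<open>D + B\<^sup>T E B' = 0\<close> with diagonal matrices
  \<open>D\<close> and \<open>E\<close>, not both zero. Since \<open>B\<^sup>T\<close> is inverted, up to the factor \<open>det B\<close>, by the cofactor
  matrix \<open>cof B\<close>, this says that \<open>cof B\<close> and \<open>B'\<close> agree up to rescaling of rows and columns
  (\<open>segre_dependent_frame_iff\<close>): \<open>y\<close> is the Gale dual, or associated configuration, of \<open>x\<close>.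

  Finally let \<open>E\<^sub>0, E\<^sub>1, E\<^sub>2\<close> and \<open>O\<^sub>0, O\<^sub>1, O\<^sub>2\<close> be the monomials of the even and of the odd
  permutations in the Leibniz expansion of \<open>det B\<close>. The six invariants span exactly the
  differences of these six monomials, so the two vectors of invariants are proportional iff,
  for some \<open>k \<noteq> 0\<close> and \<open>\<theta>\<close>, the monomials of \<open>B\<close> are \<open>k\<close> times those of \<open>B'\<close> plus the common
  shift \<open>\<theta>\<close> (\<open>bar_frame_proportional_iff\<close>). The monomials satisfy the cubic relation
  \<open>E\<^sub>0 E\<^sub>1 E\<^sub>2 = O\<^sub>0 O\<^sub>1 O\<^sub>2\<close>, both sides being the product of all nine entries. It has to hold for
  \<open>E\<^sub>j - \<theta>\<close> and \<open>O\<^sub>j - \<theta>\<close> as well; as the cubic terms in \<open>\<theta>\<close> cancel, this is a quadratic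
  equation for \<open>\<theta>\<close>. One root is \<open>\<theta> = 0\<close>, and then \<open>B\<close> and \<open>B'\<close> have proportional monomials.
  The other root is the one that turns the monomials of \<open>B\<close> into multiples of the monomials of
  \<open>cof B\<close> (\<open>even_mono_cof\<close>, \<open>odd_mono_cof\<close>), so then \<open>cof B\<close> and \<open>B'\<close> have proportional monomials.
  As proportional monomials mean agreement up to rescaling (\<open>torus_equiv_if_monomials\<close>), the two
  roots are the two alternatives of the theorem (\<open>shift_related_iff\<close>).
\<close>

section \<open>Coordinates indexed by 3 and by 6\<close>

text \<open>
  The residues are normalised to \<open>0, 1, 2\<close> so that indices computed modulo 3 are recognised
  as equal.
\<close>
lemma index_3_simps [simp]:
  "(3::3) = 0" "(4::3) = 1" "(5::3) = 2" "(-1::3) = 2" "(-2::3) = 1"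
  by simp_all

lemma forall_3': "(\<forall>i::3. P i) \<longleftrightarrow> P 0 \<and> P 1 \<and> P 2"
  using forall_3[of P] by auto

lemma UNIV_3': "UNIV = {0, 1, 2::3}"
  using UNIV_3 by auto

lemma prod_3': "prod f (UNIV::3 set) = f 0 * f 1 * f 2"
  unfolding UNIV_3' by (simp add: ac_simps)

lemma sum_3': "sum f (UNIV::3 set) = f 0 + f 1 + f 2"
  unfolding UNIV_3' by (simp add: ac_simps)

lemma forall_6: "(\<forall>i::6. P i) \<longleftrightarrow> P 1 \<and> P 2 \<and> P 3 \<and> P 4 \<and> P 5 \<and> P 6"
proof -
  have "i = 1 \<or> i = 2 \<or> i = 3 \<or> i = 4 \<or> i = 5 \<or> i = 6" for i :: 6
  proof (induct i)
    case (of_int z)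
    then have "z = 0 \<or> z = 1 \<or> z = 2 \<or> z = 3 \<or> z = 4 \<or> z = 5" by fastforce
    then show ?case by auto
  qed
  then show ?thesis by metis
qed

lemma UNIV_6: "UNIV = {1, 2, 3, 4, 5, 6::6}"
  using forall_6[of "\<lambda>i. i \<in> {1, 2, 3, 4, 5, 6}"] by auto

lemma sum_6: "sum f (UNIV::6 set) = f 1 + f 2 + f 3 + f 4 + f 5 + f 6"
  unfolding UNIV_6 by (simp add: ac_simps)

lemma vector_3_0 [simp]: "(vector [a, b, c] :: 'a::zero^3) $ 0 = c"
  using vector_3(3)[of a b c] by simp

lemma vector_6:
  "(vector [a,b,c,d,e,f] :: 'a::zero^6) $ 1 = a"
  "(vector [a,b,c,d,e,f] :: 'a^6) $ 2 = b"
  "(vector [a,b,c,d,e,f] :: 'a^6) $ 3 = c"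
  "(vector [a,b,c,d,e,f] :: 'a^6) $ 4 = d"
  "(vector [a,b,c,d,e,f] :: 'a^6) $ 5 = e"
  "(vector [a,b,c,d,e,f] :: 'a^6) $ 6 = f"
  by (simp_all add: vector_def)

section \<open>Rank deficiency as a dependency between rows\<close>

text \<open>
  The rank is the dimension spanned by the set of rows, whereas the coefficients are attached to
  row indices. Two equal rows count once in the former but are a dependency in the latter, so the
  proof treats repeated rows separately.
\<close>
lemma rank_less_iff_rows_dependent:
  fixes A :: "'a::field^'n^'m"
  shows "rank A < CARD('m) \<longleftrightarrow> (\<exists>c. (\<exists>i. c i \<noteq> 0) \<and> (\<Sum>i\<in>UNIV. c i *s A $ i) = 0)"
proof -
  have rows: "rows A = range (\<lambda>i. A $ i)"
    by (auto simp: rows_def row_def)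
  have fin: "finite (rows A)"
    by (simp add: rows)
  have card: "card (rows A) \<le> CARD('m)"
    by (simp add: rows card_image_le)
  have dim: "vec.dim (rows A) \<le> card (rows A)"
    by (rule vec.dim_le_card') (rule fin)
  show ?thesis
  proof
    assume less: "rank A < CARD('m)"
    show "\<exists>c. (\<exists>i. c i \<noteq> 0) \<and> (\<Sum>i\<in>UNIV. c i *s A $ i) = 0"
    proof (cases "inj (\<lambda>i. A $ i)")
      case False
      then obtain i j where ij: "i \<noteq> j" "A $ i = A $ j"
        by (auto simp: inj_def)
      define c where "c k = (if k = i then 1 else if k = j then - 1 else 0 :: 'a)" for k
      have "(\<Sum>k\<in>UNIV. c k *s A $ k) = (\<Sum>k\<in>{i, j}. c k *s A $ k)"
        by (rule sum.mono_neutral_right) (auto simp: c_def)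
      also have "\<dots> = 0"
        using ij by (simp add: c_def)
      finally show ?thesis
        by (intro exI[of _ c]) (auto simp: c_def)
    next
      case True
      then have "card (rows A) = CARD('m)"
        by (simp add: rows card_image)
      then have "vec.dependent (rows A)"
        using less vec.dim_eq_card_independent[of "rows A"] by (auto simp: row_rank_def_gen)
      then obtain u where u: "\<exists>v\<in>rows A. u v \<noteq> 0" "(\<Sum>v\<in>rows A. u v *s v) = 0"
        using vec.dependent_finite[OF fin] by auto
      have "(\<Sum>i\<in>UNIV. u (A $ i) *s A $ i) = (\<Sum>v\<in>rows A. u v *s v)"
        unfolding rows using True by (simp add: sum.reindex)
      with u show ?thesis
        by (intro exI[of _ "\<lambda>i. u (A $ i)"]) (auto simp: rows)
    qed
  next
    assume "\<exists>c. (\<exists>i. c i \<noteq> 0) \<and> (\<Sum>i\<in>UNIV. c i *s A $ i) = 0"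
    then obtain c i where c: "c i \<noteq> 0" "(\<Sum>i\<in>UNIV. c i *s A $ i) = 0"
      by auto
    show "rank A < CARD('m)"
    proof (rule ccontr)
      assume "\<not> rank A < CARD('m)"
      then have *: "card (rows A) \<le> vec.dim (rows A)" "card (rows A) = CARD('m)"
        using card dim by (auto simp: row_rank_def_gen)
      have ind: "vec.independent (rows A)"
        by (rule vec.card_le_dim_spanning[of _ "rows A"]) (use * fin vec.span_superset in auto)
      have inj: "inj (\<lambda>i. A $ i)"
        using *(2) by (intro eq_card_imp_inj_on) (auto simp: rows)
      define u where "u v = c (inv (\<lambda>i. A $ i) v)" for v
      have u: "u (A $ k) = c k" for k
        using inj by (simp add: u_def inv_f_f)
      have "(\<Sum>v\<in>rows A. u v *s v) = (\<Sum>k\<in>UNIV. c k *s A $ k)"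
        unfolding rows using inj by (simp add: sum.reindex u)
      then have "u (A $ i) = 0"
        using ind c vec.dependent_finite[OF fin] by (auto simp: rows)
      with c u show False
        by simp
    qed
  qed
qed

section \<open>Cofactors and the monomials of the determinant\<close>

text \<open>
  Shifting the indices cyclically makes the signs of the usual cofactor formula disappear.
\<close>
definition cof :: "'a::comm_ring_1^3^3 \<Rightarrow> 'a^3^3" where
  "cof B = (\<chi> i j. B $ (i+1) $ (j+1) * B $ (i+2) $ (j+2) - B $ (i+1) $ (j+2) * B $ (i+2) $ (j+1))"

lemma cof_rows [rule_format]:
  "\<forall>s r. (\<Sum>a\<in>UNIV. cof B $ s $ a * B $ r $ a) = (if s = r then det B else 0)"
  unfolding forall_3 by (simp add: cof_def det_3 sum_3 algebra_simps)

lemma cof_columns [rule_format]: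
  "\<forall>a b. (\<Sum>r\<in>UNIV. B $ r $ a * cof B $ r $ b) = (if a = b then det B else 0)"
  unfolding forall_3 by (simp add: cof_def det_3 sum_3 algebra_simps)

text \<open>
  The cyclic shifts \<open>i \<mapsto> i + k\<close> are the even permutations of the three indices, the reflections
  \<open>i \<mapsto> k - i\<close> the odd ones.
\<close>
definition even_mono :: "'a::comm_ring_1^3^3 \<Rightarrow> 3 \<Rightarrow> 'a" where
  "even_mono B k = (\<Prod>i\<in>UNIV. B $ i $ (i + k))"

definition odd_mono :: "'a::comm_ring_1^3^3 \<Rightarrow> 3 \<Rightarrow> 'a" where
  "odd_mono B k = (\<Prod>i\<in>UNIV. B $ i $ (k - i))"

lemma det_even_odd: "det B = (\<Sum>k\<in>UNIV. even_mono B k) - (\<Sum>k\<in>UNIV. odd_mono B k)"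
  by (simp add: det_3 even_mono_def odd_mono_def prod_3' sum_3' algebra_simps)

lemma prod_even_odd: "prod (even_mono B) UNIV = prod (odd_mono B) UNIV"
  by (simp add: even_mono_def odd_mono_def prod_3' mult_ac)

text \<open>The second elementary symmetric polynomial of three values.\<close>
definition e2 :: "(3 \<Rightarrow> 'a::comm_ring_1) \<Rightarrow> 'a" where
  "e2 f = f 0 * f 1 + f 1 * f 2 + f 2 * f 0"

text \<open>
  If \<open>det B \<noteq> 0\<close>, this says that the monomials of \<open>cof B\<close>, divided by \<open>det B\<close>, are those of \<open>B\<close>
  minus one common number. Expanding \<open>(\<Prod>j. E\<^sub>j - \<theta>) = (\<Prod>j. O\<^sub>j - \<theta>)\<close>, with \<open>E\<^sub>j\<close> and \<open>O\<^sub>j\<close> the even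
  and odd monomials of \<open>B\<close>, gives \<open>\<theta>\<close> times a linear equation in \<open>\<theta>\<close>, which this number solves.
\<close>
lemma even_mono_cof [rule_format]:
  "\<forall>k. even_mono (cof B) k = det B * even_mono B k - (e2 (even_mono B) - e2 (odd_mono B))"
  unfolding forall_3'
  by (simp add: cof_def det_3 even_mono_def odd_mono_def prod_3' e2_def algebra_simps)

lemma odd_mono_cof [rule_format]:
  "\<forall>k. odd_mono (cof B) k = det B * odd_mono B k - (e2 (even_mono B) - e2 (odd_mono B))"
  unfolding forall_3'
  by (simp add: cof_def det_3 even_mono_def odd_mono_def prod_3' e2_def algebra_simps)

section \<open>Matrices up to rescaling of rows and columns\<close>

definition torus_equiv :: "'a::field^3^3 \<Rightarrow> 'a^3^3 \<Rightarrow> bool" where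
  "torus_equiv A B \<longleftrightarrow> (\<exists>u v. (\<forall>i. u i \<noteq> 0) \<and> (\<forall>j. v j \<noteq> 0) \<and>
     (\<forall>i j. B $ i $ j = u i * v j * A $ i $ j))"

lemma torus_equiv_monomials:
  assumes "torus_equiv A B"
  obtains \<mu> where "\<mu> \<noteq> 0"
    "\<And>k. even_mono B k = \<mu> * even_mono A k"
    "\<And>k. odd_mono B k = \<mu> * odd_mono A k"
proof -
  obtain u v where uv: "\<And>i. u i \<noteq> 0" "\<And>j. v j \<noteq> 0" "\<And>i j. B $ i $ j = u i * v j * A $ i $ j"
    using assms by (auto simp: torus_equiv_def)
  let ?\<mu> = "prod u UNIV * prod v UNIV"
  have "\<forall>k. even_mono B k = ?\<mu> * even_mono A k" "\<forall>k. odd_mono B k = ?\<mu> * odd_mono A k"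
    unfolding forall_3' by (simp_all add: even_mono_def odd_mono_def prod_3' uv(3))
  with that[of ?\<mu>] uv(1,2) show thesis
    by simp
qed

text \<open>
  The six monomials of the matrix \<open>R\<close> of the entrywise ratios all have the same value. An even
  and an odd permutation of three indices that agree at one place give monomials sharing one
  entry; cancelling it shows that a \<open>2 \<times> 2\<close> minor of \<open>R\<close> vanishes. So \<open>R\<close> has rank 1, which is
  what rescaling of rows and columns means.
\<close>
lemma torus_equiv_if_monomials:
  assumes nz: "\<And>i j. A $ i $ j \<noteq> 0" "\<And>i j. B $ i $ j \<noteq> 0"
    and even: "\<And>k. even_mono B k = \<mu> * even_mono A k"
    and odd: "\<And>k. odd_mono B k = \<mu> * odd_mono A k"
  shows "torus_equiv A B"
proof -
  define R where "R i j = B $ i $ j / A $ i $ j" for i j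
  have R0: "R i j \<noteq> 0" for i j
    by (simp add: R_def nz)
  have *: "(\<Prod>i\<in>UNIV. R i (i + k)) = \<mu>" "(\<Prod>i\<in>UNIV. R i (k - i)) = \<mu>" for k
    using even[of k] odd[of k] nz
    by (simp_all add: R_def prod_dividef even_mono_def odd_mono_def)
  have "R 2 2 * (R 1 1 * R 0 0) = R 2 2 * (R 1 0 * R 0 1)"
    using *(1)[of 0] *(2)[of 1] by (simp add: prod_3' mult_ac)
  moreover have "R 2 1 * (R 1 2 * R 0 0) = R 2 1 * (R 1 0 * R 0 2)"
    using *(2)[of 0] *(1)[of 2] by (simp add: prod_3' mult_ac)
  moreover have "R 1 2 * (R 2 1 * R 0 0) = R 1 2 * (R 2 0 * R 0 1)"
    using *(2)[of 0] *(1)[of 1] by (simp add: prod_3' mult_ac)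
  moreover have "R 1 1 * (R 2 2 * R 0 0) = R 1 1 * (R 2 0 * R 0 2)"
    using *(1)[of 0] *(2)[of 2] by (simp add: prod_3' mult_ac)
  ultimately have "R 1 1 * R 0 0 = R 1 0 * R 0 1" "R 1 2 * R 0 0 = R 1 0 * R 0 2"
    "R 2 1 * R 0 0 = R 2 0 * R 0 1" "R 2 2 * R 0 0 = R 2 0 * R 0 2"
    using R0 by simp_all
  then have minors: "\<forall>i j. R i j * R 0 0 = R i 0 * R 0 j"
    unfolding forall_3' by (simp add: mult.commute)
  have "R i j = R i 0 * (R 0 j / R 0 0)" for i j
    using minors[rule_format, of i j] R0[of 0 0] by (simp add: field_simps)
  moreover have "B $ i $ j = R i j * A $ i $ j" for i j
    by (simp add: R_def nz)
  ultimately have "B $ i $ j = R i 0 * (R 0 j / R 0 0) * A $ i $ j" for i j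
    by metis
  with R0 show ?thesis
    unfolding torus_equiv_def by (intro exI[of _ "\<lambda>i. R i 0"] exI[of _ "\<lambda>j. R 0 j / R 0 0"]) simp
qed

section \<open>The frame given by the first three points\<close>

definition frame :: "complex^3^3 \<Rightarrow> 6 \<Rightarrow> complex^3" where
  "frame B i = (vector [axis 1 1, axis 2 1, axis 3 1, B $ 1, B $ 2, B $ 3] :: complex^3^6) $ i"

lemma frame_simps:
  "frame B 1 = axis 1 1" "frame B 2 = axis 2 1" "frame B 3 = axis 3 1"
  "frame B 4 = B $ 1" "frame B 5 = B $ 2" "frame B 6 = B $ 3"
  unfolding frame_def vector_6 by simp_all

lemma bracket_transform: "bracket (\<lambda>i. P *v c i) i j k = det P * bracket c i j k"
proof -
  have "(vector [P *v c i, P *v c j, P *v c k] :: complex^3^3)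
      = vector [c i, c j, c k] ** transpose P"
    by (simp add: vec_eq_iff forall_3 matrix_matrix_mult_def matrix_vector_mult_def transpose_def
        mult.commute)
  then show ?thesis
    by (simp add: bracket_def det_mul)
qed

lemma bracket_nonzero:
  assumes "general_position p" and "distinct [i, j, k]"
  shows "bracket p i j k \<noteq> 0"
proof
  let ?M = "vector [p i, p j, p k] :: complex^3^3"
  assume "bracket p i j k = 0"
  then have "\<not> invertible ?M"
    by (simp add: bracket_def invertible_det_nz)
  then obtain l where l: "l \<noteq> 0" "?M *v l = 0"
    using invertible_left_inverse matrix_left_invertible_ker by blast
  have "{i, j, k} \<subseteq> {m. on_line l (p m)}"
    using l(2) by (simp add: vec_eq_iff forall_3 matrix_vector_mult_def on_line_def mult.commute)
  then have "card {i, j, k} \<le> card {m. on_line l (p m)}"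
    by (intro card_mono) auto
  with assms l(1) show False
    by (fastforce simp: general_position_def)
qed

lemma general_position_frame:
  assumes "general_position x"
  obtains P B where "invertible P" and "x = (\<lambda>i. P *v frame B i)"
proof -
  define P where "P = transpose (vector [x 1, x 2, x 3] :: complex^3^3)"
  have "det P = bracket x 1 2 3"
    by (simp add: P_def bracket_def)
  with bracket_nonzero[OF assms, of 1 2 3] have inv: "invertible P"
    by (simp add: invertible_det_nz)
  then obtain P' where P': "P ** P' = mat 1"
    using invertible_right_inverse by blast
  have "P *v (P' *v v) = v" for v
    by (simp add: matrix_vector_mul_assoc P')
  moreover have "P *v axis k 1 = (vector [x 1, x 2, x 3] :: complex^3^3) $ k" for k
    by (simp add: vec_eq_iff matrix_vector_mult_def axis_def P_def transpose_def if_distrib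
        cong: if_cong)
  ultimately have "x i = P *v frame (vector [P' *v x 4, P' *v x 5, P' *v x 6]) i" for i
    by (rule_tac spec[of _ i]) (simp add: forall_6 frame_simps)
  with inv that show thesis
    by blast
qed

text \<open>The form that the noncollinearity of any three points takes for a frame.\<close>
definition nondegenerate :: "complex^3^3 \<Rightarrow> bool" where
  "nondegenerate B \<longleftrightarrow> det B \<noteq> 0 \<and> (\<forall>i j. B $ i $ j \<noteq> 0) \<and> (\<forall>i j. cof B $ i $ j \<noteq> 0)"

lemma frame_nondegenerate:
  assumes "general_position (\<lambda>i. P *v frame B i)"
  shows "nondegenerate B"
proof -
  have br: "bracket (frame B) i j k \<noteq> 0" if "distinct [i, j, k]" for i j k
    using bracket_nonzero[OF assms that] by (auto simp: bracket_transform)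
  note [simp] = bracket_def frame_simps det_3 axis_def
  have "det B \<noteq> 0"
    using br[of 4 5 6] by simp
  moreover have "\<forall>i j. B $ i $ j \<noteq> 0"
    using br[of 2 3 4] br[of 2 3 5] br[of 2 3 6] br[of 1 3 4] br[of 1 3 5] br[of 1 3 6]
      br[of 1 2 4] br[of 1 2 5] br[of 1 2 6]
    unfolding forall_3 by simp
  moreover have "\<forall>i j. cof B $ i $ j \<noteq> 0"
    using br[of 1 5 6] br[of 1 4 6] br[of 1 4 5] br[of 2 5 6] br[of 2 4 6] br[of 2 4 5]
      br[of 3 5 6] br[of 3 4 6] br[of 3 4 5]
    unfolding forall_3 by (simp add: cof_def algebra_simps)
  ultimately show ?thesis
    by (simp add: nondegenerate_def)
qed

section \<open>The six invariants as monomials up to a common shift\<close>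

lemma bar_vec_transform: "bar_vec (\<lambda>i. P *v c i) = (det P)\<^sup>2 *s bar_vec c"
proof -
  have "bracket2 (\<lambda>i. P *v c i) u v w = (det P)\<^sup>2 * bracket2 c u v w" for u v w
    by (cases u; cases v; cases w) (simp add: bracket_transform power2_eq_square algebra_simps)
  then show ?thesis
    by (simp add: vec_eq_iff forall_6 bar_vec_def vector_6 abar_def bbar_def cbar_def dbar_def
        ebar_def fbar_def distrib_left del: bracket2.simps)
qed

text \<open>
  In a frame, the invariants are six times the six monomials, apart from two corrections: one common to
  the odd monomials and one common to the even monomials.
\<close>
lemma bar_frame:
  fixes B
  defines "E \<equiv> even_mono B" and "N \<equiv> odd_mono B"
  shows "abar (frame B) = 2 * (3 * N 1 + det B - sum N UNIV)"
    and "bbar (frame B) = 2 * (3 * N 2 + det B - sum N UNIV)"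
    and "cbar (frame B) = 2 * (3 * N 0 + det B - sum N UNIV)"
    and "dbar (frame B) = 2 * (3 * E 2 - det B - sum E UNIV)"
    and "ebar (frame B) = 2 * (3 * E 1 - det B - sum E UNIV)"
    and "fbar (frame B) = 2 * (3 * E 0 - det B - sum E UNIV)"
  by (simp_all add: E_def N_def even_mono_def odd_mono_def det_3 prod_3' sum_3'
      abar_def bbar_def cbar_def dbar_def ebar_def fbar_def bracket_def frame_simps axis_def
      algebra_simps)

definition shift_related :: "'a::comm_ring_1 \<Rightarrow> 'a^3^3 \<Rightarrow> 'a^3^3 \<Rightarrow> bool" where
  "shift_related k B B' \<longleftrightarrow> (\<exists>\<theta>.
     (\<forall>j. even_mono B j = k * even_mono B' j + \<theta>) \<and>
     (\<forall>j. odd_mono B j = k * odd_mono B' j + \<theta>))"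

text \<open>
  The two corrections of \<open>bar_frame\<close> are tied together by \<open>det B\<close>, which can itself be read off
  from the invariants as one sixth of \<open>abar + bbar + cbar\<close>. This is why the even and the odd
  monomials are shifted by the same amount.
\<close>
lemma bar_frame_proportional_iff:
  "bar_vec (frame B) = k *s bar_vec (frame B') \<longleftrightarrow> shift_related k B B'"
proof
  let ?E = "even_mono B" and ?N = "odd_mono B"
  let ?E' = "even_mono B'" and ?N' = "odd_mono B'"
  assume "bar_vec (frame B) = k *s bar_vec (frame B')"
  then have bars: "abar (frame B) = k * abar (frame B')" "bbar (frame B) = k * bbar (frame B')"
    "cbar (frame B) = k * cbar (frame B')" "dbar (frame B) = k * dbar (frame B')"
    "ebar (frame B) = k * ebar (frame B')" "fbar (frame B) = k * fbar (frame B')"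
    by (simp_all add: vec_eq_iff forall_6 bar_vec_def vector_6)
  have sum_bars: "6 * det B = abar (frame B) + bbar (frame B) + cbar (frame B)" for B
    by (simp add: bar_frame sum_3' algebra_simps)
  have "6 * det B = 6 * (k * det B')"
    by (simp only: mult.left_commute[of 6 k] sum_bars bars distrib_left)
  then have det: "det B = k * det B'"
    by simp
  have "\<forall>j. 3 * ?N j + k * det B' - sum ?N UNIV
      = k * (3 * ?N' j + det B' - sum ?N' UNIV)"
    using bars(1-3) unfolding bar_frame det forall_3' mult.left_commute[of k 2]
    by (simp del: distrib_left_numeral right_diff_distrib_numeral)
  then have N: "\<forall>j. ?N j = k * ?N' j + (sum ?N UNIV - k * sum ?N' UNIV) / 3"
    by (simp add: field_simps)
  have "\<forall>j. 3 * ?E j - k * det B' - sum ?E UNIV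
      = k * (3 * ?E' j - det B' - sum ?E' UNIV)"
    using bars(4-6) unfolding bar_frame det forall_3' mult.left_commute[of k 2]
    by (simp del: distrib_left_numeral right_diff_distrib_numeral)
  then have E: "\<forall>j. ?E j = k * ?E' j + (sum ?E UNIV - k * sum ?E' UNIV) / 3"
    by (simp add: field_simps)
  have "sum ?E UNIV - k * sum ?E' UNIV = sum ?N UNIV - k * sum ?N' UNIV"
    using det by (simp add: det_even_odd algebra_simps)
  with N E show "shift_related k B B'"
    unfolding shift_related_def by metis
next
  assume "shift_related k B B'"
  then obtain \<theta> where "\<And>j. even_mono B j = k * even_mono B' j + \<theta>"
    "\<And>j. odd_mono B j = k * odd_mono B' j + \<theta>"
    by (auto simp: shift_related_def)
  then show "bar_vec (frame B) = k *s bar_vec (frame B')"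
    by (simp add: vec_eq_iff forall_6 bar_vec_def vector_6 bar_frame det_even_odd sum_3'
        algebra_simps)
qed

text \<open>
  The two solutions of the quadratic equation for the shift are realised by \<open>B\<close> itself and by its
  cofactor matrix.
\<close>
lemma shift_related_iff:
  assumes B: "nondegenerate B" and B': "nondegenerate B'"
  shows "(\<exists>k. k \<noteq> 0 \<and> shift_related k B B') \<longleftrightarrow> torus_equiv B' B \<or> torus_equiv B' (cof B)"
proof
  assume "\<exists>k. k \<noteq> 0 \<and> shift_related k B B'"
  then obtain k \<theta> where k: "k \<noteq> 0" and E: "\<And>j. even_mono B j = k * even_mono B' j + \<theta>"
    and N: "\<And>j. odd_mono B j = k * odd_mono B' j + \<theta>"
    by (auto simp: shift_related_def)
  show "torus_equiv B' B \<or> torus_equiv B' (cof B)"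
  proof (cases "\<theta> = 0")
    case True
    with B B' E N have "torus_equiv B' B"
      by (intro torus_equiv_if_monomials[where \<mu> = k]) (auto simp: nondegenerate_def)
    then show ?thesis ..
  next
    case False
    have "(\<Prod>j\<in>UNIV. even_mono B j - \<theta>) = (\<Prod>j\<in>UNIV. odd_mono B j - \<theta>)"
      using prod_even_odd[of B'] by (simp add: E N prod.distrib)
    \<comment> \<open>The cubic terms in \<open>\<theta>\<close> cancel, and so do the constant terms by \<open>prod_even_odd\<close>.\<close>
    then have "\<theta> * (e2 (even_mono B) - e2 (odd_mono B)) = \<theta> * (\<theta> * det B)"
      using prod_even_odd[of B]
      unfolding prod_3' e2_def det_even_odd sum_3' by algebra
    then have e2: "e2 (even_mono B) - e2 (odd_mono B) = det B * \<theta>"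
      using False by simp
    have "torus_equiv B' (cof B)"
    proof (rule torus_equiv_if_monomials[where \<mu> = "det B * k"])
      fix j
      show "even_mono (cof B) j = det B * k * even_mono B' j"
        using even_mono_cof[of B j] by (simp add: e2 E algebra_simps)
      show "odd_mono (cof B) j = det B * k * odd_mono B' j"
        using odd_mono_cof[of B j] by (simp add: e2 N algebra_simps)
    qed (use B B' in \<open>auto simp: nondegenerate_def\<close>)
    then show ?thesis ..
  qed
next
  assume "torus_equiv B' B \<or> torus_equiv B' (cof B)"
  then show "\<exists>k. k \<noteq> 0 \<and> shift_related k B B'"
  proof
    assume "torus_equiv B' B"
    then obtain \<mu> where "\<mu> \<noteq> 0" "\<And>k. even_mono B k = \<mu> * even_mono B' k"
      "\<And>k. odd_mono B k = \<mu> * odd_mono B' k"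
      by (rule torus_equiv_monomials) blast
    then show ?thesis
      unfolding shift_related_def by (intro exI[of _ \<mu>] conjI exI[of _ 0]) auto
  next
    assume "torus_equiv B' (cof B)"
    then obtain \<mu> where \<mu>: "\<mu> \<noteq> 0" "\<And>k. even_mono (cof B) k = \<mu> * even_mono B' k"
      "\<And>k. odd_mono (cof B) k = \<mu> * odd_mono B' k"
      by (rule torus_equiv_monomials) blast
    let ?\<theta> = "(e2 (even_mono B) - e2 (odd_mono B)) / det B"
    have "det B \<noteq> 0"
      using B by (simp add: nondegenerate_def)
    moreover from this have "even_mono B j = \<mu> / det B * even_mono B' j + ?\<theta>" for j
      using even_mono_cof[of B j] \<mu>(2)[of j] by (simp add: field_simps)
    moreover from \<open>det B \<noteq> 0\<close> have "odd_mono B j = \<mu> / det B * odd_mono B' j + ?\<theta>" for j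
      using odd_mono_cof[of B j] \<mu>(3)[of j] by (simp add: field_simps)
    ultimately show ?thesis
      using \<mu>(1) unfolding shift_related_def
      by (intro exI[of _ "\<mu> / det B"] conjI exI[of _ ?\<theta>]) auto
  qed
qed

section \<open>Homographies between frames\<close>

definition homographic :: "(6 \<Rightarrow> complex^3) \<Rightarrow> (6 \<Rightarrow> complex^3) \<Rightarrow> bool" where
  "homographic x y \<longleftrightarrow> (\<exists>H :: complex^3^3. invertible H \<and> (\<forall>i. y i \<sim>\<^sub>P H *v x i))"

lemma proj_eq_mult: "u \<sim>\<^sub>P v \<Longrightarrow> A *v u \<sim>\<^sub>P A *v v"
  by (auto simp: proj_eq_def matrix_vector_mult_def vec_eq_iff sum_distrib_left mult_ac)

lemma proj_eq_scale:
  assumes "c \<noteq> 0" "d \<noteq> 0"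
  shows "c *s u \<sim>\<^sub>P d *s v \<longleftrightarrow> u \<sim>\<^sub>P v"
proof
  assume "c *s u \<sim>\<^sub>P d *s v"
  then obtain k where k: "k \<noteq> 0" "c *s u = k *s (d *s v)"
    by (auto simp: proj_eq_def)
  then have "u = (k * d / c) *s v"
    using assms by (simp add: vec_eq_iff field_simps)
  with k assms show "u \<sim>\<^sub>P v"
    unfolding proj_eq_def by (intro exI[of _ "k * d / c"]) simp
next
  assume "u \<sim>\<^sub>P v"
  then obtain k where "k \<noteq> 0" "u = k *s v"
    by (auto simp: proj_eq_def)
  with assms show "c *s u \<sim>\<^sub>P d *s v"
    unfolding proj_eq_def by (intro exI[of _ "c * k / d"]) (simp add: vec_eq_iff)
qed

lemma homographic_transform_imp:
  assumes "homographic x y" "invertible P" "invertible Q"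
  shows "homographic (\<lambda>i. P *v x i) (\<lambda>i. Q *v y i)"
proof -
  obtain H where H: "invertible H" "\<And>i. y i \<sim>\<^sub>P H *v x i"
    using assms by (auto simp: homographic_def)
  obtain P' where P': "P ** P' = mat 1" "P' ** P = mat 1"
    using assms by (auto simp: invertible_def)
  have "invertible (Q ** H ** P')"
    using assms H(1) P' by (intro invertible_mult) (auto simp: invertible_def)
  moreover have "Q *v y i \<sim>\<^sub>P (Q ** H ** P') *v (P *v x i)" for i
  proof -
    have "(Q ** H ** P') *v (P *v x i) = Q *v (H *v x i)"
      by (metis P'(2) matrix_mul_assoc matrix_mul_rid matrix_vector_mul_assoc)
    then show ?thesis
      using proj_eq_mult[OF H(2)] by simp
  qed
  ultimately show ?thesis
    by (auto simp: homographic_def)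
qed

lemma invertible_cancel:
  assumes "invertible (P::complex^3^3)"
  obtains P' where "invertible P'" "\<And>v. P' *v (P *v v) = v"
  using assms unfolding invertible_def matrix_vector_mul_assoc by (metis matrix_vector_mul_lid)

lemma homographic_transform:
  assumes "invertible P" "invertible Q"
  shows "homographic (\<lambda>i. P *v x i) (\<lambda>i. Q *v y i) \<longleftrightarrow> homographic x y"
proof -
  obtain P' Q' where "invertible P'" "\<And>v. P' *v (P *v v) = v"
    and "invertible Q'" "\<And>v. Q' *v (Q *v v) = v"
    using assms by (metis invertible_cancel)
  then show ?thesis
    using homographic_transform_imp[of "\<lambda>i. P *v x i" "\<lambda>i. Q *v y i" P' Q']
      homographic_transform_imp[OF _ assms]
    by auto
qed

text \<open>
  The images of the coordinate points force the matrix of the homography to be diagonal; its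
  entries rescale the columns of \<open>B\<close>, and the scalars of the three other points rescale the rows.
\<close>
lemma homographic_frame_iff:
  "homographic (frame B) (frame B') \<longleftrightarrow> torus_equiv B' B"
proof
  assume "homographic (frame B) (frame B')"
  then obtain M c where c: "\<And>i. c i \<noteq> 0" "\<And>i. frame B' i = c i *s (M *v frame B i)"
    unfolding homographic_def proj_eq_def by metis
  define v where "v j = (vector [c 1, c 2, c 3] :: complex^3) $ j" for j
  define u where "u i = (vector [c 4, c 5, c 6] :: complex^3) $ i" for i
  have "\<forall>j. v j \<noteq> 0 \<and> u j \<noteq> 0"
    unfolding forall_3 by (simp add: v_def u_def c(1))
  then have v0: "v j \<noteq> 0" and u0: "u j \<noteq> 0" for j
    by simp_all
  have "\<forall>j. axis j 1 = v j *s (M *v axis j 1)"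
    using c(2)[of 1] c(2)[of 2] c(2)[of 3] by (simp add: forall_3 frame_simps v_def)
  then have M_axis: "(axis j 1 :: complex^3) $ i = v j * M $ i $ j" for i j
    by (simp add: vec_eq_iff matrix_vector_mult_def axis_def if_distrib cong: if_cong)
  have M: "M $ i $ j = (if i = j then 1 / v j else 0)" for i j
    using M_axis[of j i] v0[of j] by (cases "i = j") (simp_all add: axis_def field_simps)
  have "\<forall>i. B' $ i = u i *s (M *v B $ i)"
    using c(2)[of 4] c(2)[of 5] c(2)[of 6] by (simp add: forall_3 frame_simps u_def)
  then have "B' $ i $ j = u i * (B $ i $ j / v j)" for i j
    by (simp add: vec_eq_iff matrix_vector_mult_def M if_distrib if_distribR cong: if_cong)
  then have "B $ i $ j = (1 / u i) * v j * B' $ i $ j" for i j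
    using u0 v0 by simp
  with u0 v0 show "torus_equiv B' B"
    unfolding torus_equiv_def by (intro exI[of _ "\<lambda>i. 1 / u i"] exI[of _ v]) simp
next
  assume "torus_equiv B' B"
  then obtain u v where uv: "\<And>i. u i \<noteq> 0" "\<And>j. v j \<noteq> 0"
    "\<And>i j. B $ i $ j = u i * v j * B' $ i $ j"
    by (auto simp: torus_equiv_def)
  define M :: "complex^3^3" where "M = (\<chi> i j. if i = j then 1 / v j else 0)"
  have M: "(M *v w) $ i = w $ i / v i" for w i
    by (simp add: M_def matrix_vector_mult_def if_distrib if_distribR cong: if_cong)
  have "det M = (\<Prod>i\<in>UNIV. 1 / v i)"
    by (subst det_diagonal) (auto simp: M_def)
  then have "invertible M"
    using uv(2) by (simp add: invertible_det_nz)
  moreover have "\<forall>i. frame B' i \<sim>\<^sub>P M *v frame B i"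
  proof -
    have "axis j 1 \<sim>\<^sub>P M *v axis j 1" for j
      unfolding proj_eq_def using uv(2) by (intro exI[of _ "v j"]) (auto simp: vec_eq_iff M axis_def)
    moreover have "B' $ i \<sim>\<^sub>P M *v B $ i" for i
      unfolding proj_eq_def using uv(1,2)
      by (intro exI[of _ "1 / u i"]) (auto simp: vec_eq_iff M uv(3))
    ultimately show ?thesis
      by (simp add: forall_6 frame_simps)
  qed
  ultimately show "homographic (frame B) (frame B')"
    by (auto simp: homographic_def)
qed

section \<open>Rank deficiency between frames\<close>

text \<open>
  The points \<open>(x i, y i)\<close> have linearly dependent images under the Segre embedding, that is, the
  rank one matrices \<open>x i (y i)\<^sup>T\<close> satisfy a linear relation.
\<close>
definition segre_dependent :: "(6 \<Rightarrow> complex^3) \<Rightarrow> (6 \<Rightarrow> complex^3) \<Rightarrow> bool" where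
  "segre_dependent x y \<longleftrightarrow>
     (\<exists>c. (\<exists>i. c i \<noteq> 0) \<and> (\<forall>a b. (\<Sum>i\<in>UNIV. c i * x i $ a * y i $ b) = 0))"

lemma rank_Z6_less_iff: "rank (Z6 x y) < 6 \<longleftrightarrow> segre_dependent x y"
  using rank_less_iff_rows_dependent[of "Z6 x y"]
  by (simp add: segre_dependent_def Z6_def kron_def vec_eq_iff mult.assoc)

lemma segre_dependent_transform_imp:
  assumes "segre_dependent x y"
  shows "segre_dependent (\<lambda>i. P *v x i) (\<lambda>i. Q *v y i)"
proof -
  obtain c where c: "\<exists>i. c i \<noteq> 0" "\<And>a b. (\<Sum>i\<in>UNIV. c i * x i $ a * y i $ b) = 0"
    using assms by (auto simp: segre_dependent_def)
  have "(\<Sum>i\<in>UNIV. c i * (P *v x i) $ a * (Q *v y i) $ b) = 0" for a b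
  proof -
    have "(\<Sum>i\<in>UNIV. c i * (P *v x i) $ a * (Q *v y i) $ b)
        = (\<Sum>i\<in>UNIV. \<Sum>m\<in>UNIV. \<Sum>n\<in>UNIV. P $ a $ m * Q $ b $ n * (c i * x i $ m * y i $ n))"
      by (simp add: matrix_vector_mult_def sum_distrib_left sum_distrib_right mult_ac)
    also have "\<dots> = (\<Sum>m\<in>UNIV. \<Sum>n\<in>UNIV.
        P $ a $ m * Q $ b $ n * (\<Sum>i\<in>UNIV. c i * x i $ m * y i $ n))"
      unfolding sum_distrib_left
      by (subst sum.swap, rule sum.cong, rule refl, rule sum.swap)
    finally show ?thesis
      by (simp add: c)
  qed
  with c(1) show ?thesis
    by (auto simp: segre_dependent_def)
qed

lemma segre_dependent_transform:
  assumes "invertible P" "invertible Q"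
  shows "segre_dependent (\<lambda>i. P *v x i) (\<lambda>i. Q *v y i) \<longleftrightarrow> segre_dependent x y"
proof -
  obtain P' Q' where "invertible P'" "\<And>v. P' *v (P *v v) = v"
    and "invertible Q'" "\<And>v. Q' *v (Q *v v) = v"
    using assms by (metis invertible_cancel)
  then show ?thesis
    using segre_dependent_transform_imp[of "\<lambda>i. P *v x i" "\<lambda>i. Q *v y i" P' Q']
      segre_dependent_transform_imp
    by auto
qed

text \<open>
  The coefficients of the coordinate points form a diagonal matrix \<open>d\<close>, those of the other three
  points a diagonal matrix \<open>e\<close>; the relation is \<open>d + B\<^sup>T e B' = 0\<close>.
\<close>
lemma segre_dependent_frame:
  "segre_dependent (frame B) (frame B') \<longleftrightarrow>
    (\<exists>d e. ((\<exists>a. d a \<noteq> 0) \<or> (\<exists>r. e r \<noteq> 0)) \<and>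
      (\<forall>a b. (if a = b then d a else 0) + (\<Sum>r\<in>UNIV. e r * B $ r $ a * B' $ r $ b) = 0))"
  (is "_ = (\<exists>d e. ?nz d e \<and> ?rel d e)")
proof -
  have rel: "(\<forall>a b. (\<Sum>i\<in>UNIV. c i * frame B i $ a * frame B' i $ b) = 0) \<longleftrightarrow> ?rel d e"
    and nz: "(\<exists>i. c i \<noteq> 0) \<longleftrightarrow> ?nz d e"
    if "c 1 = d 1" "c 2 = d 2" "c 3 = d 3" "c 4 = e 1" "c 5 = e 2" "c 6 = e 3" for c d e
  proof -
    show "(\<forall>a b. (\<Sum>i\<in>UNIV. c i * frame B i $ a * frame B' i $ b) = 0) \<longleftrightarrow> ?rel d e"
      unfolding forall_3 sum_6 sum_3 frame_simps using that by (simp add: axis_def add.assoc)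
    show "(\<exists>i. c i \<noteq> 0) \<longleftrightarrow> ?nz d e"
      using forall_6[of "\<lambda>i. c i = 0"] forall_3[of "\<lambda>i. d i = 0"] forall_3[of "\<lambda>i. e i = 0"] that
      by simp blast
  qed
  show ?thesis
  proof
    assume "segre_dependent (frame B) (frame B')"
    then obtain c where c: "\<exists>i. c i \<noteq> 0"
      "\<forall>a b. (\<Sum>i\<in>UNIV. c i * frame B i $ a * frame B' i $ b) = 0"
      by (auto simp: segre_dependent_def)
    let ?d = "\<lambda>j. (vector [c 1, c 2, c 3] :: complex^3) $ j"
      and ?e = "\<lambda>j. (vector [c 4, c 5, c 6] :: complex^3) $ j"
    have "?nz ?d ?e \<and> ?rel ?d ?e"
      using c rel[of c ?d ?e] nz[of c ?d ?e] by simp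
    then show "\<exists>d e. ?nz d e \<and> ?rel d e"
      by blast
  next
    assume "\<exists>d e. ?nz d e \<and> ?rel d e"
    then obtain d e where de: "?nz d e" "?rel d e"
      by blast
    let ?c = "\<lambda>i. (vector [d 1, d 2, d 3, e 1, e 2, e 3] :: complex^6) $ i"
    show "segre_dependent (frame B) (frame B')"
      unfolding segre_dependent_def
      using de rel[of ?c d e] nz[of ?c d e] by (intro exI[of _ ?c]) (simp add: vector_6)
  qed
qed

text \<open>
  Multiplying \<open>d + B\<^sup>T e B' = 0\<close> by \<open>cof B\<close> from the left gives \<open>cof B d + det B e B' = 0\<close>. As the
  entries of \<open>cof B\<close> and of \<open>B'\<close> do not vanish, one zero among the coefficients would make all of
  them zero; so \<open>d\<close> and \<open>e\<close> can be inverted, and \<open>cof B\<close> is a rescaling of \<open>B'\<close>.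
\<close>
lemma segre_dependent_frame_iff:
  assumes B: "nondegenerate B" and B': "nondegenerate B'"
  shows "segre_dependent (frame B) (frame B') \<longleftrightarrow> torus_equiv B' (cof B)"
proof
  assume "segre_dependent (frame B) (frame B')"
  then obtain d e where de: "(\<exists>a. d a \<noteq> 0) \<or> (\<exists>r. e r \<noteq> 0)"
    and rel: "\<And>a b. (if a = b then d a else 0) + (\<Sum>r\<in>UNIV. e r * B $ r $ a * B' $ r $ b) = 0"
    unfolding segre_dependent_frame by blast
  have key: "cof B $ s $ b * d b + det B * e s * B' $ s $ b = 0" for s b
  proof -
    have "0 = (\<Sum>a\<in>UNIV. cof B $ s $ a *
        ((if a = b then d a else 0) + (\<Sum>r\<in>UNIV. e r * B $ r $ a * B' $ r $ b)))"
      by (simp add: rel)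
    also have "\<dots> = cof B $ s $ b * d b
        + (\<Sum>a\<in>UNIV. \<Sum>r\<in>UNIV. e r * B' $ r $ b * (cof B $ s $ a * B $ r $ a))"
      by (simp add: distrib_left sum.distrib sum_distrib_left mult_delta_right mult_ac)
    also have "(\<Sum>a\<in>UNIV. \<Sum>r\<in>UNIV. e r * B' $ r $ b * (cof B $ s $ a * B $ r $ a))
       = (\<Sum>r\<in>UNIV. e r * B' $ r $ b * (\<Sum>a\<in>UNIV. cof B $ s $ a * B $ r $ a))"
      unfolding sum_distrib_left by (rule sum.swap)
    also have "\<dots> = det B * e s * B' $ s $ b"
      unfolding cof_rows by (simp add: mult_delta_right mult_ac)
    finally show ?thesis
      by simp
  qed
  have nz: "det B \<noteq> 0" "cof B $ i $ j \<noteq> 0" "B' $ i $ j \<noteq> 0" for i j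
    using B B' by (auto simp: nondegenerate_def)
  have "d b = 0 \<longleftrightarrow> e s = 0" for s b
    using key[of s b] nz by auto
  with de have d0: "d b \<noteq> 0" and e0: "e s \<noteq> 0" for s b
    by blast+
  have "cof B $ s $ b = (- det B * e s) * (1 / d b) * B' $ s $ b" for s b
    using key[of s b] d0[of b] by (simp add: field_simps add_eq_0_iff)
  with d0 e0 nz show "torus_equiv B' (cof B)"
    unfolding torus_equiv_def
    by (intro exI[of _ "\<lambda>s. - det B * e s"] exI[of _ "\<lambda>b. 1 / d b"]) simp
next
  assume "torus_equiv B' (cof B)"
  then obtain u v where uv: "\<And>i. u i \<noteq> 0" "\<And>j. v j \<noteq> 0"
    "\<And>i j. cof B $ i $ j = u i * v j * B' $ i $ j"
    by (auto simp: torus_equiv_def)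
  have "(\<Sum>r\<in>UNIV. u r * B $ r $ a * B' $ r $ b) = (if a = b then det B / v b else 0)" for a b
  proof -
    have "(\<Sum>r\<in>UNIV. u r * B $ r $ a * B' $ r $ b) = (\<Sum>r\<in>UNIV. B $ r $ a * cof B $ r $ b) / v b"
      using uv(2)[of b] by (simp add: uv(3) sum_divide_distrib mult_ac)
    then show ?thesis
      by (simp add: cof_columns)
  qed
  with uv show "segre_dependent (frame B) (frame B')"
    unfolding segre_dependent_frame
    by (intro exI[of _ "\<lambda>b. - det B / v b"] exI[of _ u]) auto
qed

section \<open>The theorem\<close>

theorem theorem6p7:
  fixes x y :: "6 \<Rightarrow> complex^3"
  assumes "\<And>i. x i \<noteq> 0" and "\<And>i. y i \<noteq> 0"
    and "general_position x" and "general_position y"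
  shows "bar_vec x \<sim>\<^sub>P bar_vec y \<longleftrightarrow>
    rank (Z6 x y) < 6 \<or>
    (\<exists>H :: complex^3^3. invertible H \<and> (\<forall>i. y i \<sim>\<^sub>P H *v x i))"
proof -
  obtain P B where P: "invertible P" and x: "x = (\<lambda>i. P *v frame B i)"
    using general_position_frame[OF assms(3)] .
  obtain Q B' where Q: "invertible Q" and y: "y = (\<lambda>i. Q *v frame B' i)"
    using general_position_frame[OF assms(4)] .
  have B: "nondegenerate B" and B': "nondegenerate B'"
    using assms(3,4) frame_nondegenerate unfolding x y by blast+
  have "bar_vec x \<sim>\<^sub>P bar_vec y \<longleftrightarrow> bar_vec (frame B) \<sim>\<^sub>P bar_vec (frame B')"
  proof -
    have d: "det P \<noteq> 0" "det Q \<noteq> 0"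
      using P Q by (simp_all add: invertible_det_nz)
    then show ?thesis
      unfolding x y bar_vec_transform by (simp add: proj_eq_scale)
  qed
  also have "\<dots> \<longleftrightarrow> torus_equiv B' B \<or> torus_equiv B' (cof B)"
    unfolding proj_eq_def bar_frame_proportional_iff by (rule shift_related_iff[OF B B'])
  also have "torus_equiv B' (cof B) \<longleftrightarrow> rank (Z6 x y) < 6"
    unfolding rank_Z6_less_iff x y segre_dependent_transform[OF P Q]
      segre_dependent_frame_iff[OF B B'] ..
  also have "torus_equiv B' B \<longleftrightarrow> homographic x y"
    unfolding x y homographic_transform[OF P Q] homographic_frame_iff ..
  finally show ?thesis
    unfolding homographic_def by blast
qed

end
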